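(* Let $X=\{x_1,\dots,x_n\}$ be a finite set with $n\ge 1$ elements in a fixed enumeration, and let $(X,\bullet)$ be a groupoid with the orientation property. Then the $JO$-factorization of $(X,\bullet)$ is unique: there is exactly one pair of groupoids $(X,\circ)$, $(X,\ast)$ such that $(X,\circ)$ is a skew-factor of $(X,\bullet)$, $(X,\ast)$ is an orient-factor of $(X,\bullet)$, and $(X,\bullet)=(X,\circ)\diamond(X,\ast)$.
   Context: A groupoid $(X,\bullet)$ is a non-empty set $X$ with an arbitrary binary operation $\bullet:X\times X\to X$. It has the orientation property if $x\bullet y\in\{x,y\}$ for all $x,y\in X$. For groupoids $(X,\ast_1)$, $(X,\ast_2)$ on the same set $X$, the product $(X,\ast_1)\diamond(X,\ast_2)$ is the groupoid $(X,\cdot)$ with $x\cdot y=(x\ast_1 y)\ast_2(y\ast_1 x)$ for all $x,y\in X$. Let $X=\{x_1,\dots,x_n\}$ be finite with a fixed enumeration. A groupoid $(X,\ast)$ is an orient-factor of $(X,\bullet)$ if $x_i\ast x_j=x_j$ whenever $i+j=n+1$, and $x_i\ast x_j=x_i$ otherwise. A groupoid $(X,\circ)$ is a skew-factor of $(X,\bullet)$ if $x_i\circ x_j=x_j\bullet x_i$ whenever $i+j=n+1$, and $x_i\circ x_j=x_i\bullet x_j$ otherwise. *)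

theory Defs
  imports "HOL-Library.FuncSet"
begin

text \<open>
  Operations on X are required to be extensional (equal to \<open>undefined\<close> outside X), so that HOL
  equality of two of them is equality of the groupoids on X.
\<close>

definition groupoid :: "'a set \<Rightarrow> ('a \<Rightarrow> 'a \<Rightarrow> 'a) \<Rightarrow> bool" where
  "groupoid X f \<longleftrightarrow> X \<noteq> {} \<and> f \<in> X \<rightarrow>\<^sub>E (X \<rightarrow>\<^sub>E X)"

definition orientation_property :: "'a set \<Rightarrow> ('a \<Rightarrow> 'a \<Rightarrow> 'a) \<Rightarrow> bool" where
  "orientation_property X f \<longleftrightarrow> (\<forall>x\<in>X. \<forall>y\<in>X. f x y \<in> {x, y})"

definition groupoid_product ::
  "'a set \<Rightarrow> ('a \<Rightarrow> 'a \<Rightarrow> 'a) \<Rightarrow> ('a \<Rightarrow> 'a \<Rightarrow> 'a) \<Rightarrow> ('a \<Rightarrow> 'a \<Rightarrow> 'a)" where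
  "groupoid_product X f g = (\<lambda>x\<in>X. \<lambda>y\<in>X. g (f x y) (f y x))"

definition enumeration :: "'a set \<Rightarrow> nat \<Rightarrow> (nat \<Rightarrow> 'a) \<Rightarrow> bool" where
  "enumeration X n x \<longleftrightarrow> bij_betw x {1..n} X"

text \<open>
  \<open>orient_factor X n x f g\<close> and \<open>skew_factor X n x f g\<close> say that \<open>(X, g)\<close> is an orient-factor,
  respectively a skew-factor, of \<open>(X, f)\<close> for the enumeration \<open>x 1, \<dots>, x n\<close> of X.
  The defining equations of an orient-factor do not involve \<open>f\<close>.
\<close>

definition orient_factor ::
  "'a set \<Rightarrow> nat \<Rightarrow> (nat \<Rightarrow> 'a) \<Rightarrow> ('a \<Rightarrow> 'a \<Rightarrow> 'a) \<Rightarrow> ('a \<Rightarrow> 'a \<Rightarrow> 'a) \<Rightarrow> bool" where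
  "orient_factor X n x f g \<longleftrightarrow> groupoid X g \<and>
     (\<forall>i\<in>{1..n}. \<forall>j\<in>{1..n}. g (x i) (x j) = (if i + j = n + 1 then x j else x i))"

definition skew_factor ::
  "'a set \<Rightarrow> nat \<Rightarrow> (nat \<Rightarrow> 'a) \<Rightarrow> ('a \<Rightarrow> 'a \<Rightarrow> 'a) \<Rightarrow> ('a \<Rightarrow> 'a \<Rightarrow> 'a) \<Rightarrow> bool" where
  "skew_factor X n x f g \<longleftrightarrow> groupoid X g \<and>
     (\<forall>i\<in>{1..n}. \<forall>j\<in>{1..n}.
        g (x i) (x j) = (if i + j = n + 1 then f (x j) (x i) else f (x i) (x j)))"

end

theory Submission imports Defs begin

text \<open>Every element of \<open>X\<close> is some \<open>x i\<close>, and both operations are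
  \<open>undefined\<close> outside \<open>X\<close>. Agreement on the indexed pairs therefore leaves
  no room for a difference, so the conclusion is genuine HOL equality.\<close>

lemma groupoid_eqI:
  assumes x: "bij_betw x A X" and "groupoid X g" "groupoid X h"
    and eq: "\<And>i j. i \<in> A \<Longrightarrow> j \<in> A \<Longrightarrow> g (x i) (x j) = h (x i) (x j)"
  shows "g = h"
proof (rule PiE_ext)
  show g: "g \<in> X \<rightarrow>\<^sub>E (X \<rightarrow>\<^sub>E X)" and h: "h \<in> X \<rightarrow>\<^sub>E (X \<rightarrow>\<^sub>E X)"
    using assms by (auto simp: groupoid_def)
  fix a assume a: "a \<in> X"
  show "g a = h a"
  proof (rule PiE_ext)
    show "g a \<in> X \<rightarrow>\<^sub>E X" "h a \<in> X \<rightarrow>\<^sub>E X"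
      using g h a by (auto elim: PiE_mem)
    fix b assume b: "b \<in> X"
    show "g a b = h a b"
      using a b eq x by (auto simp: bij_betw_def)
  qed
qed

text \<open>Both kinds of factor are given by prescribing a value for each pair of indices. As
  \<open>x\<close> is a bijection, every element has exactly one index, so the table carries over to
  \<open>X\<close> without conflict; the inverse of \<open>x\<close> yields the witness.\<close>

lemma ex1_groupoid_table:
  assumes x: "bij_betw x A X" and "X \<noteq> {}"
    and t: "\<And>i j. i \<in> A \<Longrightarrow> j \<in> A \<Longrightarrow> t i j \<in> X"
  shows "\<exists>!g. groupoid X g \<and> (\<forall>i\<in>A. \<forall>j\<in>A. g (x i) (x j) = t i j)"
proof (rule ex_ex1I)
  let ?k = "the_inv_into A x"
  let ?g = "\<lambda>a\<in>X. \<lambda>b\<in>X. t (?k a) (?k b)"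
  have inj: "inj_on x A" and img: "\<And>i. i \<in> A \<Longrightarrow> x i \<in> X"
    using x by (auto simp: bij_betw_def)
  have "?k a \<in> A" if "a \<in> X" for a
    using bij_betw_the_inv_into[OF x] that by (auto simp: bij_betw_def)
  then have "groupoid X ?g"
    using t \<open>X \<noteq> {}\<close> by (auto simp: groupoid_def)
  moreover have "\<forall>i\<in>A. \<forall>j\<in>A. ?g (x i) (x j) = t i j"
    using img by (simp add: the_inv_into_f_f[OF inj])
  ultimately show "\<exists>g. groupoid X g \<and> (\<forall>i\<in>A. \<forall>j\<in>A. g (x i) (x j) = t i j)"
    by blast
next
  fix g h
  assume "groupoid X g \<and> (\<forall>i\<in>A. \<forall>j\<in>A. g (x i) (x j) = t i j)"
    and "groupoid X h \<and> (\<forall>i\<in>A. \<forall>j\<in>A. h (x i) (x j) = t i j)"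
  then show "g = h"
    by (intro groupoid_eqI[OF x]) simp_all
qed

lemma groupoid_groupoid_product:
  assumes "groupoid X f" "groupoid X g"
  shows "groupoid X (groupoid_product X f g)"
proof -
  have "f a b \<in> X" "g a b \<in> X" if "a \<in> X" "b \<in> X" for a b
    using assms that unfolding groupoid_def by (meson PiE_mem)+
  then show ?thesis
    using assms by (auto simp: groupoid_def groupoid_product_def)
qed

text \<open>
  Where the skew-factor swaps \<open>f x\<^sub>i x\<^sub>j\<close> and \<open>f x\<^sub>j x\<^sub>i\<close>, the orient-factor projects to its second
  argument, so both swaps cancel. If the two products coincide, the orient-factor is evaluated on
  the diagonal, where it is the identity under either rule.
\<close>
lemma JO_factors_product:
  assumes x: "enumeration X n x" and f: "groupoid X f" "orientation_property X f"
    and s: "skew_factor X n x f s" and g: "orient_factor X n x f g"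
  shows "f = groupoid_product X s g"
proof (rule groupoid_eqI)
  show bij: "bij_betw x {1..n} X"
    using x by (simp add: enumeration_def)
  show "groupoid X f" "groupoid X (groupoid_product X s g)"
    using f s g by (auto simp: skew_factor_def orient_factor_def intro: groupoid_groupoid_product)
  fix i j assume ij: "i \<in> {1..n}" "j \<in> {1..n}"
  then have X: "x i \<in> X" "x j \<in> X"
    using bij by (auto simp: bij_betw_def)
  have fX: "f (x i) (x j) \<in> {x i, x j}" "f (x j) (x i) \<in> {x i, x j}"
    using f(2) X by (auto simp: orientation_property_def)
  have g': "g (x k) (x l) = (if k + l = n + 1 then x l else x k)"
    if "k \<in> {1..n}" "l \<in> {1..n}" for k l
    using g that by (simp add: orient_factor_def)
  have s': "s (x k) (x l) = (if k + l = n + 1 then f (x l) (x k) else f (x k) (x l))"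
    if "k \<in> {1..n}" "l \<in> {1..n}" for k l
    using s that by (simp add: skew_factor_def)
  have "groupoid_product X s g (x i) (x j) = g (s (x i) (x j)) (s (x j) (x i))"
    using X by (simp add: groupoid_product_def)
  \<comment> \<open>By \<open>fX\<close> both arguments of \<open>g\<close> lie among
    \<open>x i\<close> and \<open>x j\<close>, so four instances of \<open>g'\<close> cover all
    cases. The diagonal ones return \<open>x i\<close> and \<open>x j\<close> even when the doubled
    index is \<open>n + 1\<close>.\<close>
  also have "\<dots> = f (x i) (x j)"
    using fX g'[OF ij] g'[OF ij(2,1)] g'[OF ij(1,1)] g'[OF ij(2,2)] s'[OF ij] s'[OF ij(2,1)]
    by (auto simp: add.commute split: if_splits)
  finally show "f (x i) (x j) = groupoid_product X s g (x i) (x j)" ..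
qed

theorem corollary4p2p4:
  fixes X :: "'a set" and n :: nat and x :: "nat \<Rightarrow> 'a" and f :: "'a \<Rightarrow> 'a \<Rightarrow> 'a"
  assumes "n \<ge> 1"
    and "enumeration X n x"
    and "groupoid X f"
    and "orientation_property X f"
  shows "\<exists>!p. case p of (s, g) \<Rightarrow>
           skew_factor X n x f s \<and> orient_factor X n x f g \<and> f = groupoid_product X s g"
proof -
  have bij: "bij_betw x {1..n} X" and ne: "X \<noteq> {}"
    using assms by (auto simp: enumeration_def groupoid_def)
  have xX: "x i \<in> X" if "i \<in> {1..n}" for i
    using bij that by (auto simp: bij_betw_def)
  have fX: "f a b \<in> X" if "a \<in> X" "b \<in> X" for a b
    using assms(3) that unfolding groupoid_def by (meson PiE_mem)
  \<comment> \<open>Each factor is determined separately by its own table; closure of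
    \<open>f\<close> on \<open>X\<close> keeps the entries for \<open>s\<close> inside
    \<open>X\<close>.\<close>
  have "\<exists>!s. skew_factor X n x f s"
    unfolding skew_factor_def by (rule ex1_groupoid_table[OF bij ne]) (simp add: xX fX)
  then obtain s where s: "skew_factor X n x f s" "\<And>s'. skew_factor X n x f s' \<Longrightarrow> s' = s"
    by (elim ex1E) blast
  have "\<exists>!g. orient_factor X n x f g"
    unfolding orient_factor_def by (rule ex1_groupoid_table[OF bij ne]) (simp add: xX)
  then obtain g where g: "orient_factor X n x f g" "\<And>g'. orient_factor X n x f g' \<Longrightarrow> g' = g"
    by (elim ex1E) blast
  show ?thesis
  \<comment> \<open>Uniqueness of the pair is componentwise. The orientation property enters through
    the product equation for this pair.\<close>
  proof (rule ex1I[of _ "(s, g)"])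
    show "case (s, g) of (s, g) \<Rightarrow>
        skew_factor X n x f s \<and> orient_factor X n x f g \<and> f = groupoid_product X s g"
      unfolding prod.case
      by (intro conjI s(1) g(1) JO_factors_product[OF assms(2-4)])
  qed (use s(2) g(2) in blast)
qed

end
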